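(* Without loss of generality, suppose $r_1\le r_2\le\cdots\le r_N$ and $\delta_1\le\delta_2\le\cdots\le\delta_I$. For any $\gamma\ge0$, the worst-case null distribution of an ordinal test statistic $T$ satisfies $$\alpha(T,\mathbf{r},\mathbf{u}^+)=\max_{\mathbf{u}\in\mathcal{U}_{\rm O}}\alpha(T,\mathbf{r},\mathbf{u}),$$ where $\mathcal{U}_{\rm O}=\{\mathbf{u}\in\{0,1\}^N: u_1\le u_2\le\cdots\le u_N\}=\{(0,\dots,0),(0,\dots,0,1),\dots,(1,\dots,1)\}$, and the size of the candidate set $\mathcal{U}_{\rm O}$ is $|\mathcal{U}_{\rm O}|=N+1$.
   Context: There are $N$ subjects, $I$ treatment levels and $J$ outcome levels, and positive integers $N_{1\cdot},\dots,N_{I\cdot}$ with $\sum_i N_{i\cdot}=N$. Let $\mathcal{Z}(\mathbf{N}_{I\cdot})=\{\mathbf{z}\in\{1,\dots,I\}^N:\ |\{s:z_s=i\}|=N_{i\cdot}\ \forall i\}$. The outcome vector $\mathbf{r}=(r_1,\dots,r_N)\in\{1,\dots,J\}^N$ is fixed (sharp null hypothesis of no treatment effect). For $\mathbf{z}\in\mathcal{Z}(\mathbf{N}_{I\cdot})$, $\mathbf{N}(\mathbf{z},\mathbf{r})$ is the $I\times J$ table with entries $N_{ij}=\sum_{s=1}^N\mathbb{1}\{z_s=i,r_s=j\}$. An ordinal test statistic is a function of the table of the form $T(\mathbf{N})=\sum_{i=1}^I\sum_{j=1}^J w_iv_jN_{ij}$ for some fixed weights $w_1\le\cdots\le w_I$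 and $v_1\le\cdots\le v_J$. For sensitivity parameters $\gamma\ge0$ and $\boldsymbol\delta=(\delta_1,\dots,\delta_I)\in\{0,1\}^I$ (not all entries equal), threshold $c\in\mathbb{R}$, and $\mathbf{u}\in[0,1]^N$ (unmeasured confounder), $$\alpha(T,\mathbf{r},\mathbf{u})=\frac{\sum_{\mathbf{z}\in\mathcal{Z}(\mathbf{N}_{I\cdot})}\mathbb{1}\{T(\mathbf{N}(\mathbf{z},\mathbf{r}))\ge c\}\exp\{\gamma\sum_{s=1}^N\delta_{z_s}u_s\}}{\sum_{\mathbf{b}\in\mathcal{Z}(\mathbf{N}_{I\cdot})}\exp\{\gamma\sum_{s=1}^N\delta_{b_s}u_s\}}.$$ The worst-case unmeasured confounder is $\mathbf{u}^+=\operatorname{argmax}_{\mathbf{u}\in[0,1]^N}\alpha(T,\mathbf{r},\mathbf{u})$, and the worst-case null distribution is $\alpha(T,\mathbf{r},\mathbf{u}^+)=\max_{\mathbf{u}\in[0,1]^N}\alpha(T,\mathbf{r},\mathbf{u})$. *)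

theory Defs
  imports Complex_Main "HOL-Library.FuncSet"
begin

(* Subjects are 1..N, treatment levels 1..I, outcome levels 1..J.  Assignments and confounders
   are extensional functions on {1..N}, so that the sets of them below are in bijection with the
   corresponding sets of N-tuples; this matters for the sums over assignments and for
   cardinalities. *)

definition assignments :: "nat \<Rightarrow> nat \<Rightarrow> (nat \<Rightarrow> nat) \<Rightarrow> (nat \<Rightarrow> nat) set" where
  "assignments N I n =
     {z \<in> {1..N} \<rightarrow>\<^sub>E {1..I}. \<forall>i\<in>{1..I}. card {s \<in> {1..N}. z s = i} = n i}"

definition contingency_table ::
  "nat \<Rightarrow> (nat \<Rightarrow> nat) \<Rightarrow> (nat \<Rightarrow> nat) \<Rightarrow> nat \<Rightarrow> nat \<Rightarrow> nat" where
  "contingency_table N z r i j = (\<Sum>s = 1..N. of_bool (z s = i \<and> r s = j))"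

definition ordinal_statistic :: "nat \<Rightarrow> nat \<Rightarrow> ((nat \<Rightarrow> nat \<Rightarrow> nat) \<Rightarrow> real) \<Rightarrow> bool" where
  "ordinal_statistic I J T \<longleftrightarrow>
     (\<exists>w v :: nat \<Rightarrow> real. mono_on {1..I} w \<and> mono_on {1..J} v \<and>
        (\<forall>A. T A = (\<Sum>i = 1..I. \<Sum>j = 1..J. w i * v j * real (A i j))))"

definition null_tail ::
  "nat \<Rightarrow> nat \<Rightarrow> (nat \<Rightarrow> nat) \<Rightarrow> real \<Rightarrow> (nat \<Rightarrow> real) \<Rightarrow> real \<Rightarrow>
   ((nat \<Rightarrow> nat \<Rightarrow> nat) \<Rightarrow> real) \<Rightarrow> (nat \<Rightarrow> nat) \<Rightarrow> (nat \<Rightarrow> real) \<Rightarrow> real" where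
  "null_tail N I n \<gamma> \<delta> c T r u =
     (\<Sum>z\<in>assignments N I n.
        of_bool (T (contingency_table N z r) \<ge> c) * exp (\<gamma> * (\<Sum>s = 1..N. \<delta> (z s) * u s))) /
     (\<Sum>b\<in>assignments N I n. exp (\<gamma> * (\<Sum>s = 1..N. \<delta> (b s) * u s)))"

definition confounders :: "nat \<Rightarrow> (nat \<Rightarrow> real) set" where
  "confounders N = {1..N} \<rightarrow>\<^sub>E {0..1}"

(* A relation rather than a choice operator: the maximizer need not be unique, and its
   existence is not built in. *)
definition worst_case_confounder ::
  "nat \<Rightarrow> nat \<Rightarrow> (nat \<Rightarrow> nat) \<Rightarrow> real \<Rightarrow> (nat \<Rightarrow> real) \<Rightarrow> real \<Rightarrow>
   ((nat \<Rightarrow> nat \<Rightarrow> nat) \<Rightarrow> real) \<Rightarrow> (nat \<Rightarrow> nat) \<Rightarrow> (nat \<Rightarrow> real) \<Rightarrow> bool" where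
  "worst_case_confounder N I n \<gamma> \<delta> c T r u \<longleftrightarrow>
     is_arg_max (null_tail N I n \<gamma> \<delta> c T r) (\<lambda>u. u \<in> confounders N) u"

definition ordinal_candidates :: "nat \<Rightarrow> (nat \<Rightarrow> real) set" where
  "ordinal_candidates N = {u \<in> {1..N} \<rightarrow>\<^sub>E {0, 1}. mono_on {1..N} u}"

end

theory Submission
  imports Defs "HOL-Combinatorics.Permutations"
begin

text \<open>
  As a function of a single coordinate, the tail probability is \<open>(A + B * y) / (C + D * y)\<close> with
  \<open>y = exp (\<gamma> * u s)\<close>, hence monotone in \<open>y\<close>, so every confounder is dominated by a binary one.
  For a binary confounder with an inversion \<open>u s = 1\<close>, \<open>u t = 0\<close>, \<open>s < t\<close>, exchanging the two values
  leaves the denominator unchanged. Pairing each assignment \<open>z\<close> with the assignment in which the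
  treatments of \<open>s\<close> and \<open>t\<close> are exchanged shows that the numerator does not decrease, because the
  statistic and the weight respond to this exchange with the same sign. Repeating the
  exchange sorts \<open>u\<close>.
\<close>

section \<open>Relabelling the subjects\<close>

lemma assignments_permute:
  assumes z: "z \<in> assignments N I n" and p: "p permutes {1..N}"
  shows "z \<circ> p \<in> assignments N I n"
proof -
  have "card {s \<in> {1..N}. (z \<circ> p) s = i} = card {s \<in> {1..N}. z s = i}" for i
  proof (rule bij_betw_same_card[of p], rule bij_betw_imageI)
    show "inj_on p {s \<in> {1..N}. (z \<circ> p) s = i}"
      using permutes_inj[OF p] by (rule inj_on_subset) simp
    show "p ` {s \<in> {1..N}. (z \<circ> p) s = i} = {s \<in> {1..N}. z s = i}"
    proof (intro subset_antisym subsetI)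
      fix s assume "s \<in> {s \<in> {1..N}. z s = i}"
      then show "s \<in> p ` {s \<in> {1..N}. (z \<circ> p) s = i}"
        using permutes_inverses(1)[OF p, of s] permutes_in_image[OF permutes_inv[OF p], of s]
        by (intro image_eqI[of _ _ "inv p s"]) auto
    next
      fix s assume "s \<in> p ` {s \<in> {1..N}. (z \<circ> p) s = i}"
      then obtain t where "s = p t" "t \<in> {1..N}" "z (p t) = i" by auto
      then show "s \<in> {s \<in> {1..N}. z s = i}"
        using permutes_in_image[OF p, of t] by simp
    qed
  qed
  moreover have "z \<circ> p \<in> {1..N} \<rightarrow>\<^sub>E {1..I}"
  proof (rule PiE_I)
    have zE: "z \<in> {1..N} \<rightarrow>\<^sub>E {1..I}" using z by (simp add: assignments_def)
    fix s
    show "(z \<circ> p) s \<in> {1..I}" if "s \<in> {1..N}"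
      using PiE_mem[OF zE, of "p s"] permutes_in_image[OF p, of s] that by simp
    \<comment> \<open>\<open>p\<close> fixes every point outside \<open>{1..N}\<close>, so
      \<open>z \<circ> p\<close> keeps the default value there and stays extensional.\<close>
    show "(z \<circ> p) s = undefined" if "s \<notin> {1..N}"
      using PiE_arb[OF zE that] permutes_not_in[OF p that] by simp
  qed
  ultimately show ?thesis
    using z by (simp add: assignments_def)
qed

text \<open>Composition with \<open>p\<close> is a bijection of the assignments, inverted by
  composition with \<open>inv p\<close>. This is the change of variables behind pairing each
  assignment with its exchanged version.\<close>

lemma sum_assignments_permute:
  assumes p: "p permutes {1..N}"
  shows "(\<Sum>z\<in>assignments N I n. f (z \<circ> p)) = (\<Sum>z\<in>assignments N I n. f z)"
proof (rule sum.reindex_bij_witness[of _ "\<lambda>z. z \<circ> inv p" "\<lambda>z. z \<circ> p"])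
  fix z assume "z \<in> assignments N I n"
  then show "z \<circ> p \<in> assignments N I n" "z \<circ> inv p \<in> assignments N I n"
    using assignments_permute p permutes_inv[OF p] by blast+
qed (simp_all add: o_assoc[symmetric] permutes_inv_o[OF p])

section \<open>Sums over subjects and their response to an exchange\<close>

text \<open>Each subject lies in exactly one cell of the table, so the double sum collapses to one
  term per subject. In this form the effect of exchanging two treatments can be read off.\<close>

lemma weighted_table_sum:
  fixes w v :: "nat \<Rightarrow> real"
  assumes "z \<in> {1..N} \<rightarrow> {1..I}" and "r \<in> {1..N} \<rightarrow> {1..J}"
  shows "(\<Sum>i = 1..I. \<Sum>j = 1..J. w i * v j * real (contingency_table N z r i j)) =
         (\<Sum>s = 1..N. w (z s) * v (r s))"
proof -
  have "(\<Sum>i = 1..I. \<Sum>j = 1..J. w i * v j * real (contingency_table N z r i j)) =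
        (\<Sum>i = 1..I. \<Sum>s = 1..N. \<Sum>j = 1..J. w i * v j * of_bool (z s = i \<and> r s = j))"
    unfolding contingency_table_def of_nat_sum sum_distrib_left
    by (rule sum.cong[OF refl], rule trans[OF sum.swap]) simp
  also have "\<dots> = (\<Sum>s = 1..N. \<Sum>i = 1..I. \<Sum>j = 1..J. w i * v j * of_bool (z s = i \<and> r s = j))"
    by (rule sum.swap)
  also have "\<dots> = (\<Sum>s = 1..N. w (z s) * v (r s))"
  proof (rule sum.cong[OF refl])
    fix s assume s: "s \<in> {1..N}"
    have "(\<Sum>i = 1..I. \<Sum>j = 1..J. w i * v j * of_bool (z s = i \<and> r s = j)) =
          (\<Sum>i = 1..I. if z s = i then \<Sum>j = 1..J. if r s = j then w i * v j else 0 else 0)"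
      by (rule sum.cong[OF refl]) (auto intro!: sum.cong)
    also have "\<dots> = w (z s) * v (r s)"
      using s assms by (auto simp: Pi_iff)
    finally show "(\<Sum>i = 1..I. \<Sum>j = 1..J. w i * v j * of_bool (z s = i \<and> r s = j)) =
      w (z s) * v (r s)" .
  qed
  finally show ?thesis .
qed

text \<open>Only the terms at \<open>s\<close> and \<open>t\<close> change. This serves three times:
  for the statistic, for the exponent of the weight, and for the potential \<open>pos\<close> used
  in sorting.\<close>

lemma sum_times_transpose:
  fixes a b :: "nat \<Rightarrow> real"
  assumes "finite S" "s \<in> S" "t \<in> S" "s \<noteq> t"
  shows "(\<Sum>x\<in>S. a (transpose s t x) * b x) - (\<Sum>x\<in>S. a x * b x) = (a t - a s) * (b s - b t)"
proof -
  have "(\<Sum>x\<in>S. a (transpose s t x) * b x) - (\<Sum>x\<in>S. a x * b x) =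
        (\<Sum>x\<in>S. (a (transpose s t x) - a x) * b x)"
    by (simp add: sum_subtractf left_diff_distrib)
  also have "\<dots> = (\<Sum>x\<in>{s, t}. (a (transpose s t x) - a x) * b x)"
    by (rule sum.mono_neutral_right) (use assms in \<open>auto simp: transpose_def\<close>)
  also have "\<dots> = (a t - a s) * (b s - b t)"
    using assms(4) by (simp add: algebra_simps)
  finally show ?thesis .
qed

section \<open>Reduction to binary confounders\<close>

text \<open>Where the denominator is positive, the derivative in \<open>y\<close> has the sign of
  \<open>B * C - A * D\<close>, so the ratio is monotone. The condition on \<open>C = 0\<close> and
  \<open>D = 0\<close> admits an empty set of assignments, where every ratio is 0 by the convention
  for division by zero.\<close>

lemma affine_ratio_le_endpoint:
  fixes A B C D x y z :: real
  assumes "C \<ge> 0" "D \<ge> 0" "C = 0 \<and> D = 0 \<longrightarrow> A = 0 \<and> B = 0"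
    and "0 < x" "x \<le> y" "y \<le> z"
  shows "(A + B * y) / (C + D * y) \<le> (A + B * x) / (C + D * x) \<or>
         (A + B * y) / (C + D * y) \<le> (A + B * z) / (C + D * z)"
proof (cases "C = 0 \<and> D = 0")
  case True
  then show ?thesis using assms(3) by simp
next
  case False
  have pos: "C + D * q > 0" if "q > 0" for q
  proof (cases "D = 0")
    case True
    then show ?thesis using False assms(1) by simp
  next
    case False
    then have "D * q > 0" using that assms(2) by simp
    then show ?thesis using assms(1) by linarith
  qed
  have le: "(A + B * p) / (C + D * p) \<le> (A + B * q) / (C + D * q)"
    if "p > 0" "q > 0" "0 \<le> (B * C - A * D) * (q - p)" for p q
  proof -
    \<comment> \<open>Right side minus left side is
      \<open>(B * C - A * D) * (q - p)\<close>.\<close>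
    have "(A + B * p) * (C + D * q) \<le> (A + B * q) * (C + D * p)"
      using that(3) by (simp add: algebra_simps)
    then show ?thesis
      using pos[OF that(1)] pos[OF that(2)] by (simp add: pos_divide_le_eq pos_le_divide_eq)
  qed
  show ?thesis
  proof (cases "0 \<le> B * C - A * D")
    case True
    then show ?thesis using le[of y z] assms by simp
  next
    case False
    then show ?thesis using le[of y x] assms by (simp add: mult_nonpos_nonpos)
  qed
qed

text \<open>Since \<open>\<delta>\<close> is 0 or 1, a value \<open>x\<close> at subject
  \<open>s\<close> multiplies the weight by 1 or by \<open>exp (\<gamma> * x)\<close>. Splitting the
  assignments accordingly makes numerator and denominator affine in
  \<open>exp (\<gamma> * x)\<close>.\<close>

lemma null_tail_coordinate:
  assumes s: "s \<in> {1..N}" and \<delta>: "\<delta> \<in> {1..I} \<rightarrow> {0, 1}" and \<gamma>: "\<gamma> \<ge> 0"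
    and u: "u s \<in> {0..1}"
  shows "\<exists>b\<in>{0, 1}. null_tail N I n \<gamma> \<delta> c T r u \<le> null_tail N I n \<gamma> \<delta> c T r (u(s := b))"
proof -
  let ?Z = "assignments N I n"
  \<comment> \<open>The weight contributed by the other subjects, independent of the value at
    \<open>s\<close>.\<close>
  define k where "k z = exp (\<gamma> * (\<Sum>t\<in>{1..N} - {s}. \<delta> (z t) * u t))" for z
  define h :: "(nat \<Rightarrow> nat) \<Rightarrow> real" where "h z = of_bool (T (contingency_table N z r) \<ge> c)" for z
  define A where "A = (\<Sum>z\<in>?Z. h z * k z * of_bool (\<delta> (z s) = 0))"
  define B where "B = (\<Sum>z\<in>?Z. h z * k z * of_bool (\<delta> (z s) = 1))"
  define C where "C = (\<Sum>z\<in>?Z. k z * of_bool (\<delta> (z s) = 0))"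
  define D where "D = (\<Sum>z\<in>?Z. k z * of_bool (\<delta> (z s) = 1))"
  have weight: "exp (\<gamma> * (\<Sum>t = 1..N. \<delta> (z t) * (u(s := x)) t)) =
      k z * of_bool (\<delta> (z s) = 0) + k z * of_bool (\<delta> (z s) = 1) * exp (\<gamma> * x)"
    if "z \<in> ?Z" for z x
  proof -
    have "(\<Sum>t = 1..N. \<delta> (z t) * (u(s := x)) t) =
          \<delta> (z s) * x + (\<Sum>t\<in>{1..N} - {s}. \<delta> (z t) * (u(s := x)) t)"
      using s by (subst sum.remove[of _ s]) auto
    also have "(\<Sum>t\<in>{1..N} - {s}. \<delta> (z t) * (u(s := x)) t) = (\<Sum>t\<in>{1..N} - {s}. \<delta> (z t) * u t)"
      by (rule sum.cong) auto
    finally have "exp (\<gamma> * (\<Sum>t = 1..N. \<delta> (z t) * (u(s := x)) t)) = k z * exp (\<gamma> * (\<delta> (z s) * x))"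
      by (simp add: k_def distrib_left exp_add)
    moreover have "\<delta> (z s) \<in> {0, 1}"
      using that s \<delta> by (auto simp: assignments_def PiE_iff Pi_iff)
    ultimately show ?thesis by auto
  qed
  have ratio: "null_tail N I n \<gamma> \<delta> c T r (u(s := x)) =
      (A + B * exp (\<gamma> * x)) / (C + D * exp (\<gamma> * x))" for x
  proof -
    have "(\<Sum>z\<in>?Z. h z * exp (\<gamma> * (\<Sum>t = 1..N. \<delta> (z t) * (u(s := x)) t))) = A + B * exp (\<gamma> * x)"
      unfolding A_def B_def sum_distrib_right sum.distrib[symmetric]
      by (intro sum.cong refl, subst weight) (auto simp: algebra_simps)
    moreover have "(\<Sum>z\<in>?Z. exp (\<gamma> * (\<Sum>t = 1..N. \<delta> (z t) * (u(s := x)) t))) = C + D * exp (\<gamma> * x)"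
      unfolding C_def D_def sum_distrib_right sum.distrib[symmetric]
      by (intro sum.cong refl, subst weight) auto
    ultimately show ?thesis
      unfolding null_tail_def h_def by simp
  qed
  \<comment> \<open>As \<open>h\<close> is at most 1, the denominator parts dominate the numerator
    parts, so \<open>C = D = 0\<close> forces \<open>A = B = 0\<close>.\<close>
  have le: "0 \<le> A" "0 \<le> B" "A \<le> C" "B \<le> D"
    unfolding A_def B_def C_def D_def
    by (auto intro!: sum_nonneg sum_mono simp: h_def k_def)
  have "exp (\<gamma> * 0) \<le> exp (\<gamma> * u s)" "exp (\<gamma> * u s) \<le> exp (\<gamma> * 1)"
    using u \<gamma> by (auto simp: mult_left_le)
  then have "(A + B * exp (\<gamma> * u s)) / (C + D * exp (\<gamma> * u s)) \<le>
        (A + B * exp (\<gamma> * 0)) / (C + D * exp (\<gamma> * 0)) \<or>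
      (A + B * exp (\<gamma> * u s)) / (C + D * exp (\<gamma> * u s)) \<le>
        (A + B * exp (\<gamma> * 1)) / (C + D * exp (\<gamma> * 1))"
    using le by (intro affine_ratio_le_endpoint) auto
  then show ?thesis
    unfolding ratio[symmetric] fun_upd_triv by blast
qed

lemma null_tail_binary:
  assumes \<delta>: "\<delta> \<in> {1..I} \<rightarrow> {0, 1}" and \<gamma>: "\<gamma> \<ge> 0" and u: "u \<in> confounders N"
  shows "\<exists>u' \<in> {1..N} \<rightarrow>\<^sub>E {0, 1}. null_tail N I n \<gamma> \<delta> c T r u \<le> null_tail N I n \<gamma> \<delta> c T r u'"
proof -
  \<comment> \<open>\<open>S\<close> is the set of coordinates already rounded; rounding one more
    leaves these untouched.\<close>
  have "\<exists>u'\<in>confounders N. (\<forall>s\<in>S. u' s \<in> {0, 1}) \<and>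
      null_tail N I n \<gamma> \<delta> c T r u \<le> null_tail N I n \<gamma> \<delta> c T r u'"
    if "finite S" "S \<subseteq> {1..N}" for S
    using that
  proof (induction S rule: finite_induct)
    case empty
    then show ?case using u by auto
  next
    case (insert s S)
    then obtain u' where u': "u' \<in> confounders N" "\<forall>s\<in>S. u' s \<in> {0, 1}"
        "null_tail N I n \<gamma> \<delta> c T r u \<le> null_tail N I n \<gamma> \<delta> c T r u'"
      by auto
    have s: "s \<in> {1..N}" using insert.prems by auto
    then have "u' s \<in> {0..1}" using u'(1) by (auto simp: confounders_def PiE_iff)
    from null_tail_coordinate[where u = u', OF s \<delta> \<gamma> this] obtain b :: real where b: "b \<in> {0, 1}"
        "null_tail N I n \<gamma> \<delta> c T r u' \<le> null_tail N I n \<gamma> \<delta> c T r (u'(s := b))"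
      by blast
    have "u'(s := b) \<in> confounders N"
      using u'(1) s b(1) by (auto simp: confounders_def PiE_iff extensional_def)
    moreover have "\<forall>t\<in>insert s S. (u'(s := b)) t \<in> {0, 1}"
      using u'(2) b(1) by auto
    ultimately show ?case
      using order_trans[OF u'(3) b(2)] by blast
  qed
  from this[of "{1..N}"] obtain u' where "u' \<in> confounders N" "\<forall>s\<in>{1..N}. u' s \<in> {0, 1}"
      "null_tail N I n \<gamma> \<delta> c T r u \<le> null_tail N I n \<gamma> \<delta> c T r u'"
    by auto
  then show ?thesis
    by (intro bexI[of _ u']) (auto simp: confounders_def PiE_iff)
qed

section \<open>Exchanging an inversion and sorting\<close>

lemma null_tail_transpose:
  assumes st: "s \<in> {1..N}" "t \<in> {1..N}" "s < t" and inv: "u t \<le> u s"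
    and r: "r \<in> {1..N} \<rightarrow> {1..J}" "mono_on {1..N} r"
    and \<delta>: "mono_on {1..I} \<delta>" and \<gamma>: "\<gamma> \<ge> 0" and T: "ordinal_statistic I J T"
  shows "null_tail N I n \<gamma> \<delta> c T r u \<le> null_tail N I n \<gamma> \<delta> c T r (u \<circ> transpose s t)"
proof -
  let ?Z = "assignments N I n" and ?p = "transpose s t"
  let ?u = "u \<circ> ?p"
  define E where "E u z = exp (\<gamma> * (\<Sum>x = 1..N. \<delta> (z x) * u x))" for u :: "nat \<Rightarrow> real" and z
  define h :: "(nat \<Rightarrow> nat) \<Rightarrow> real" where "h z = of_bool (T (contingency_table N z r) \<ge> c)" for z
  have p: "?p permutes {1..N}" using st by (intro permutes_swap_id)
  \<comment> \<open>Relabelling confounder and assignment together only reorders the exponent. As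
    \<open>?p\<close> is an involution, exchanging in the assignment therefore amounts to exchanging
    in the confounder.\<close>
  have E_swap: "E (v \<circ> ?p) (z \<circ> ?p) = E v z" for v z
    unfolding E_def by (subst (2) sum.permute[OF p]) (simp add: o_def)
  have pp: "?p \<circ> ?p = id" by (simp add: fun_eq_iff)
  have E_swap': "E u (z \<circ> ?p) = E ?u z" for z
    using E_swap[of ?u z] by (simp add: o_assoc[symmetric] pp)
  have denom: "(\<Sum>z\<in>?Z. E ?u z) = (\<Sum>z\<in>?Z. E u z)"
    using sum_assignments_permute[OF p, of "E u"] by (simp add: E_swap')
  obtain w v where w: "mono_on {1..I} w" and v: "mono_on {1..J} v"
    and Teq: "\<And>A. T A = (\<Sum>i = 1..I. \<Sum>j = 1..J. w i * v j * real (A i j))"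
    using T unfolding ordinal_statistic_def by blast
  have "0 \<le> (h z - h (z \<circ> ?p)) * (E ?u z - E u z)" if z: "z \<in> ?Z" for z
  proof -
    have z': "z \<circ> ?p \<in> ?Z" using assignments_permute[OF z p] .
    have zI: "z \<in> {1..N} \<rightarrow> {1..I}" "z \<circ> ?p \<in> {1..N} \<rightarrow> {1..I}"
      using z z' by (auto simp: assignments_def PiE_iff)
    have zst: "z s \<in> {1..I}" "z t \<in> {1..I}" using zI(1) st by auto
    have T_diff: "T (contingency_table N (z \<circ> ?p) r) - T (contingency_table N z r) =
        (w (z t) - w (z s)) * (v (r s) - v (r t))"
      unfolding Teq weighted_table_sum[OF zI(1) r(1)] weighted_table_sum[OF zI(2) r(1)]
      using sum_times_transpose[of "{1..N}" s t "\<lambda>x. w (z x)" "\<lambda>x. v (r x)"] st by simp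
    have v_le: "v (r s) \<le> v (r t)"
      using st r by (intro mono_onD[OF v] mono_onD[OF r(2)]) auto
    have h_le: "h (z \<circ> ?p) \<le> h z" if "w (z s) \<le> w (z t)"
    proof -
      have "(w (z t) - w (z s)) * (v (r s) - v (r t)) \<le> 0"
        using that v_le by (intro mult_nonneg_nonpos) auto
      then show ?thesis using T_diff by (simp add: h_def)
    qed
    have h_ge: "h z \<le> h (z \<circ> ?p)" if "w (z t) \<le> w (z s)"
    proof -
      have "0 \<le> (w (z t) - w (z s)) * (v (r s) - v (r t))"
        using that v_le by (intro mult_nonpos_nonpos) auto
      then show ?thesis using T_diff by (simp add: h_def)
    qed
    have E_diff: "(\<Sum>x = 1..N. \<delta> (z x) * ?u x) - (\<Sum>x = 1..N. \<delta> (z x) * u x) =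
        (u t - u s) * (\<delta> (z s) - \<delta> (z t))"
      using sum_times_transpose[of "{1..N}" s t u "\<lambda>x. \<delta> (z x)"] st by (simp add: mult.commute)
    \<comment> \<open>The order of the two treatments decides both signs at once: \<open>w\<close>
      and \<open>\<delta>\<close> are monotone, so both factors are nonnegative if
      \<open>z s \<le> z t\<close> and nonpositive otherwise.\<close>
    show ?thesis
    proof (cases "z s \<le> z t")
      case True
      then have "w (z s) \<le> w (z t)" "\<delta> (z s) \<le> \<delta> (z t)"
        using zst mono_onD[OF w] mono_onD[OF \<delta>] by auto
      moreover from this have "0 \<le> (u t - u s) * (\<delta> (z s) - \<delta> (z t))"
        using inv by (intro mult_nonpos_nonpos) auto
      ultimately show ?thesis
        using h_le E_diff \<gamma> by (intro mult_nonneg_nonneg) (auto simp: E_def intro!: mult_left_mono)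
    next
      case False
      then have "w (z t) \<le> w (z s)" "\<delta> (z t) \<le> \<delta> (z s)"
        using zst mono_onD[OF w] mono_onD[OF \<delta>] by auto
      moreover from this have "(u t - u s) * (\<delta> (z s) - \<delta> (z t)) \<le> 0"
        using inv by (intro mult_nonpos_nonneg) auto
      ultimately show ?thesis
        using h_ge E_diff \<gamma> by (intro mult_nonpos_nonpos) (auto simp: E_def intro!: mult_left_mono)
    qed
  qed
  then have "0 \<le> (\<Sum>z\<in>?Z. (h z - h (z \<circ> ?p)) * (E ?u z - E u z))"
    by (rule sum_nonneg)
  also have "\<dots> = (\<Sum>z\<in>?Z. h z * E ?u z) - (\<Sum>z\<in>?Z. h z * E u z)
      - (\<Sum>z\<in>?Z. h (z \<circ> ?p) * E ?u z) + (\<Sum>z\<in>?Z. h (z \<circ> ?p) * E u z)"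
    by (simp add: algebra_simps sum.distrib sum_subtractf)
  \<comment> \<open>Reindexing turns the two sums with \<open>h (z \<circ> ?p)\<close> into the old
    and the new numerator, so the nonnegative sum is twice the gain of the numerator.\<close>
  also have "(\<Sum>z\<in>?Z. h (z \<circ> ?p) * E ?u z) = (\<Sum>z\<in>?Z. h z * E u z)"
    using sum_assignments_permute[OF p, of "\<lambda>z. h z * E u z"] by (simp add: E_swap')
  also have "(\<Sum>z\<in>?Z. h (z \<circ> ?p) * E u z) = (\<Sum>z\<in>?Z. h z * E ?u z)"
    using sum_assignments_permute[OF p, of "\<lambda>z. h z * E ?u z"] by (simp add: E_swap)
  finally have "(\<Sum>z\<in>?Z. h z * E u z) \<le> (\<Sum>z\<in>?Z. h z * E ?u z)"
    by linarith
  then have "(\<Sum>z\<in>?Z. h z * E u z) / (\<Sum>z\<in>?Z. E u z) \<le> (\<Sum>z\<in>?Z. h z * E ?u z) / (\<Sum>z\<in>?Z. E ?u z)"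
    unfolding denom by (intro divide_right_mono sum_nonneg) (auto simp: E_def)
  then show ?thesis
    unfolding null_tail_def h_def E_def .
qed

text \<open>The repeated exchange is replaced by an extremal choice: among the binary maximizers
  take one with the largest \<open>pos\<close>, which rewards ones at late positions. Removing an
  inversion would give a maximizer with larger \<open>pos\<close>.\<close>

lemma null_tail_ordinal:
  assumes r: "r \<in> {1..N} \<rightarrow> {1..J}" "mono_on {1..N} r"
    and \<delta>: "\<delta> \<in> {1..I} \<rightarrow> {0, 1}" "mono_on {1..I} \<delta>"
    and \<gamma>: "\<gamma> \<ge> 0" and T: "ordinal_statistic I J T"
  shows "\<exists>u'\<in>ordinal_candidates N. \<forall>u\<in>confounders N.
    null_tail N I n \<gamma> \<delta> c T r u \<le> null_tail N I n \<gamma> \<delta> c T r u'"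
proof -
  let ?\<alpha> = "null_tail N I n \<gamma> \<delta> c T r"
  let ?B = "{1..N} \<rightarrow>\<^sub>E {0, 1 :: real}"
  define m where "m = Max (?\<alpha> ` ?B)"
  define M where "M = {u \<in> ?B. ?\<alpha> u = m}"
  define pos where "pos u = (\<Sum>s = 1..N. u s * real s)" for u
  have fin: "finite ?B" by (intro finite_PiE) auto
  have "?B \<noteq> {}" by (simp add: PiE_eq_empty_iff)
  with fin have "m \<in> ?\<alpha> ` ?B"
    unfolding m_def by (intro Max_in) auto
  then have M: "finite M" "M \<noteq> {}"
    using fin by (auto simp: M_def)
  have max: "?\<alpha> u \<le> m" if "u \<in> ?B" for u
    unfolding m_def using that fin by (intro Max_ge) auto
  obtain u where u: "u \<in> M" and u_max: "\<And>u'. u' \<in> M \<Longrightarrow> pos u' \<le> pos u"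
    using Max_in[of "pos ` M"] Max_ge[of "pos ` M"] M by fastforce
  have uB: "u \<in> ?B" and um: "?\<alpha> u = m" using u by (auto simp: M_def)
  have "mono_on {1..N} u"
  proof (rule mono_onI, rule ccontr)
    fix s t assume st: "s \<in> {1..N}" "t \<in> {1..N}" "s \<le> t" and less: "\<not> u s \<le> u t"
    then have "s < t" by (cases "s = t") auto
    let ?u = "u \<circ> transpose s t"
    have p: "transpose s t permutes {1..N}" using st by (intro permutes_swap_id)
    have "?u \<in> ?B"
      using uB permutes_in_image[OF p] permutes_not_in[OF p]
      by (auto simp: PiE_iff extensional_def)
    moreover have "?\<alpha> u \<le> ?\<alpha> ?u"
      using less by (intro null_tail_transpose[OF st(1,2) \<open>s < t\<close> _ r \<delta>(2) \<gamma> T]) simp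
    \<comment> \<open>The exchange cannot lower the value, and \<open>m\<close> bounds it, so
      \<open>?u\<close> is again a maximizer.\<close>
    ultimately have "?u \<in> M" using um max[of ?u] by (simp add: M_def)
    then have "pos ?u \<le> pos u" by (rule u_max)
    moreover have "pos ?u - pos u = (u t - u s) * (real s - real t)"
      using sum_times_transpose[of "{1..N}" s t u real] st \<open>s < t\<close> by (simp add: pos_def)
    moreover have "(u t - u s) * (real s - real t) > 0"
      using less \<open>s < t\<close> by (intro mult_neg_neg) auto
    ultimately show False by linarith
  qed
  with uB have "u \<in> ordinal_candidates N" by (simp add: ordinal_candidates_def)
  moreover have "?\<alpha> u' \<le> ?\<alpha> u" if "u' \<in> confounders N" for u'
    using null_tail_binary[OF \<delta>(1) \<gamma> that, of n c T r] max order_trans unfolding um by blast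
  ultimately show ?thesis by blast
qed

section \<open>The candidate set\<close>

text \<open>A monotone binary vector is determined by the position of its last zero;
  \<open>k\<close> counts the ones, which occupy the last \<open>k\<close> subjects.\<close>

lemma ordinal_candidates_eq:
  "ordinal_candidates N = (\<lambda>k. \<lambda>s\<in>{1..N}. of_bool (N - k < s)) ` {0..N}"
proof (intro subset_antisym subsetI)
  fix u assume "u \<in> ordinal_candidates N"
  then have uB: "u \<in> {1..N} \<rightarrow>\<^sub>E {0, 1}" and mono: "mono_on {1..N} u"
    by (auto simp: ordinal_candidates_def)
  define D where "D = {s \<in> {1..N}. u s = 0}"
  \<comment> \<open>The inserted 0 gives \<open>m = 0\<close> when there are no zeros, that is, for
    the all-ones vector.\<close>
  define m where "m = Max (insert 0 D)"
  have D: "finite D" by (simp add: D_def)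
  have m: "m \<in> insert 0 D" unfolding m_def using D by (intro Max_in) auto
  then have mN: "m \<le> N" by (auto simp: D_def)
  have "u s = of_bool (m < s)" if s: "s \<in> {1..N}" for s
  proof (cases "m < s")
    case True
    moreover have "s \<le> m" if "s \<in> D" using D that by (simp add: m_def)
    ultimately have "u s \<noteq> 0" using s by (auto simp: D_def)
    then show ?thesis using True uB s by (auto simp: PiE_iff)
  next
    case False
    \<comment> \<open>Here \<open>1 \<le> s \<le> m\<close>, so \<open>m\<close> is not the inserted
      0 but a genuine zero of \<open>u\<close>.\<close>
    then have "m \<in> {1..N}" "u m = 0" using m s by (auto simp: D_def)
    then have "u s \<le> 0" using mono_onD[OF mono s, of m] False by simp
    moreover have "u s = 0 \<or> u s = 1" using uB s by (auto simp: PiE_iff)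
    ultimately show ?thesis using False by auto
  qed
  then have "u = (\<lambda>s\<in>{1..N}. of_bool (N - (N - m) < s))"
    using uB mN by (intro extensionalityI[of _ "{1..N}"]) (auto simp: PiE_iff)
  then show "u \<in> (\<lambda>k. \<lambda>s\<in>{1..N}. of_bool (N - k < s)) ` {0..N}"
    by (intro image_eqI[of _ _ "N - m"]) auto
next
  fix u :: "nat \<Rightarrow> real"
  assume "u \<in> (\<lambda>k. \<lambda>s\<in>{1..N}. of_bool (N - k < s)) ` {0..N}"
  then show "u \<in> ordinal_candidates N"
    by (auto simp: ordinal_candidates_def mono_on_def)
qed

lemma card_ordinal_candidates: "card (ordinal_candidates N) = N + 1"
proof -
  let ?f = "\<lambda>k. \<lambda>s\<in>{1..N}. of_bool (N - k < s) :: real"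
  have "?f k \<noteq> ?f l" if "k < l" "l \<le> N" for k l
  proof
    assume "?f k = ?f l"
    \<comment> \<open>\<open>N - l + 1\<close> is the first subject with value 1 under
      \<open>?f l\<close>; under \<open>?f k\<close>, with fewer ones, it still has value 0.\<close>
    then have "?f k (N - l + 1) = ?f l (N - l + 1)" by (rule fun_cong)
    moreover have "N - l + 1 \<in> {1..N}" "N - k \<ge> N - l + 1" using that by auto
    ultimately show False by simp
  qed
  then have "inj_on ?f {0..N}"
    by (intro linorder_inj_onI) auto
  then show ?thesis
    unfolding ordinal_candidates_eq by (simp add: card_image)
qed

theorem theorem2:
  fixes N I J :: nat
    and n :: "nat \<Rightarrow> nat"
    and r :: "nat \<Rightarrow> nat"
    and \<delta> :: "nat \<Rightarrow> real"
    and \<gamma> c :: real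
    and T :: "(nat \<Rightarrow> nat \<Rightarrow> nat) \<Rightarrow> real"
  assumes "\<And>i. i \<in> {1..I} \<Longrightarrow> n i > 0"
    and "(\<Sum>i = 1..I. n i) = N"
    and "r \<in> {1..N} \<rightarrow> {1..J}"
    and "mono_on {1..N} r"
    and "\<delta> \<in> {1..I} \<rightarrow> {0, 1}"
    and "\<exists>i\<in>{1..I}. \<exists>k\<in>{1..I}. \<delta> i \<noteq> \<delta> k"
    and "mono_on {1..I} \<delta>"
    and "\<gamma> \<ge> 0"
    and "ordinal_statistic I J T"
  shows "(\<exists>u. worst_case_confounder N I n \<gamma> \<delta> c T r u) \<and>
    (\<forall>u. worst_case_confounder N I n \<gamma> \<delta> c T r u \<longrightarrow>
       null_tail N I n \<gamma> \<delta> c T r u = Max (null_tail N I n \<gamma> \<delta> c T r ` ordinal_candidates N)) \<and>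
    ordinal_candidates N = (\<lambda>k. \<lambda>s\<in>{1..N}. of_bool (N - k < s)) ` {0..N} \<and>
    card (ordinal_candidates N) = N + 1"
proof -
  let ?\<alpha> = "null_tail N I n \<gamma> \<delta> c T r"
  obtain u0 where u0: "u0 \<in> ordinal_candidates N" and le: "\<And>u. u \<in> confounders N \<Longrightarrow> ?\<alpha> u \<le> ?\<alpha> u0"
    using null_tail_ordinal[of r N J \<delta> I \<gamma> T n c] assms by blast
  have sub: "ordinal_candidates N \<subseteq> confounders N"
    unfolding ordinal_candidates_def confounders_def
    using PiE_mono[of "{1..N}" "\<lambda>_. {0, 1}" "\<lambda>_. {0..1 :: real}"] by auto
  have "finite (ordinal_candidates N)"
    unfolding ordinal_candidates_eq by simp
  then have "Max (?\<alpha> ` ordinal_candidates N) = ?\<alpha> u0"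
    using u0 le sub by (intro Max_eqI) auto
  \<comment> \<open>This characterization yields both the existence of a worst case, namely
    \<open>u0\<close>, and the common value of all of them.\<close>
  moreover have "worst_case_confounder N I n \<gamma> \<delta> c T r u \<longleftrightarrow> u \<in> confounders N \<and> ?\<alpha> u = ?\<alpha> u0" for u
    unfolding worst_case_confounder_def is_arg_max_linorder using u0 le sub
    by (auto intro: antisym)
  ultimately show ?thesis
    using u0 sub ordinal_candidates_eq card_ordinal_candidates by auto
qed

end
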